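(* Let $\lambda^\star$ be a minimizer of $\phi_{\rm se}$ and let the block $B\subseteq\{1,\dots,m\}$ satisfy $A_{B,:}\neq0$. If some positive semidefinite matrix $\Psi_B$ and some $\nu_B\ge0$ satisfy $$\nabla^2_{BB}\phi_{\rm se}(\lambda)\preceq\Psi_B+\nu_BF(\lambda)I_B\qquad\text{for every }\lambda\in\mathbb R^m,$$ then $\nu_B\ge\rho_B^2/\gamma^2$. Moreover, this value cannot be reached in general: if row $i$ is a scaled indicator row, i.e. $A_{ij}\in\{0,\rho_i\}$ for all $j$ with $\rho_i=\max_j|A_{ij}|>0$, then there is no finite $\kappa_i$ with $$\partial^2_{ii}\phi_{\rm se}(\lambda)\le\kappa_i+\frac{\rho_i^2}{\gamma^2}F(\lambda)\qquad\text{for every }\lambda\in\mathbb R^m.$$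
   Context: Let $A\in\mathbb R^{m\times n}$ with columns $a_1,\dots,a_n$, $b\in\mathbb R^m$, $c\in\mathbb R^n$, $\gamma>0$. Standing assumption: there is $q\in\mathbb R^m$ with $A^\top q=\mathbf 1$ and $\langle q,b\rangle=1$, and there is $\bar x>0$ (entrywise) with $A\bar x=b$. The sum-exp dual is $\phi_{\rm se}(\lambda)=-\langle b,\lambda\rangle+\gamma\sum_{j=1}^n\exp((a_j^\top\lambda-c_j)/\gamma)$; its minimum $\phi_{\rm se}^\star$ is attained and $F=\phi_{\rm se}-\phi_{\rm se}^\star$. $\nabla^2_{BB}$ is the diagonal Hessian block indexed by $B$, $A_{B,:}$ the submatrix of rows in $B$, $A_{B,j}$ its $j$-th column, $\rho_B=\max_j\|A_{B,j}\|_2$, $\preceq$ the Loewner order. *)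

theory Defs
  imports "HOL-Analysis.Analysis"
begin

definition sum_exp_dual ::
    "real^'n^'m \<Rightarrow> real^'m \<Rightarrow> real^'n \<Rightarrow> real \<Rightarrow> real^'m \<Rightarrow> real" where
  "sum_exp_dual A b c \<gamma> u =
     - (b \<bullet> u) + \<gamma> * (\<Sum>j\<in>UNIV. exp ((column j A \<bullet> u - c $ j) / \<gamma>))"

definition sum_exp_gap ::
    "real^'n^'m \<Rightarrow> real^'m \<Rightarrow> real^'n \<Rightarrow> real \<Rightarrow> real^'m \<Rightarrow> real" where
  "sum_exp_gap A b c \<gamma> u = sum_exp_dual A b c \<gamma> u - (INF v. sum_exp_dual A b c \<gamma> v)"

definition partial_deriv :: "'m::finite \<Rightarrow> (real^'m \<Rightarrow> real) \<Rightarrow> real^'m \<Rightarrow> real" where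
  "partial_deriv i f u = deriv (\<lambda>t. f (u + t *\<^sub>R axis i 1)) 0"

definition hessian :: "(real^'m \<Rightarrow> real) \<Rightarrow> real^'m \<Rightarrow> real^'m^'m" where
  "hessian f u = (\<chi> i j. partial_deriv i (partial_deriv j f) u)"

text \<open>A matrix indexed by a block \<open>B\<close> is represented by a full matrix of which only the
  entries with both indices in \<open>B\<close> are inspected. Thus \<open>psd_on B M\<close> says that the
  principal submatrix of \<open>M\<close> on \<open>B\<close> is positive semidefinite (which includes symmetry),
  and \<open>loewner_le_on B M N\<close> is the Loewner order between the principal submatrices
  of \<open>M\<close> and \<open>N\<close> on \<open>B\<close>.\<close>

definition psd_on :: "'m::finite set \<Rightarrow> real^'m^'m \<Rightarrow> bool" where
  "psd_on B M \<longleftrightarrow>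
     (\<forall>i\<in>B. \<forall>j\<in>B. M $ i $ j = M $ j $ i) \<and>
     (\<forall>v::real^'m. 0 \<le> (\<Sum>i\<in>B. \<Sum>j\<in>B. v $ i * M $ i $ j * v $ j))"

definition loewner_le_on :: "'m::finite set \<Rightarrow> real^'m^'m \<Rightarrow> real^'m^'m \<Rightarrow> bool" where
  "loewner_le_on B M N \<longleftrightarrow> psd_on B (N - M)"

definition block_radius :: "real^'n^'m \<Rightarrow> 'm set \<Rightarrow> real" where
  "block_radius A B = Max (range (\<lambda>j. L2_set (\<lambda>i. A $ i $ j) B))"

definition row_radius :: "real^'n^'m \<Rightarrow> 'm \<Rightarrow> real" where
  "row_radius A i = Max (range (\<lambda>j. \<bar>A $ i $ j\<bar>))"

end

theory Submission
  imports Defs "HOL-Real_Asymp.Real_Asymp"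
begin

text \<open>
  Write \<open>p\<^sub>j(u) = exp ((a\<^sub>j \<bullet> u - c\<^sub>j) / \<gamma>)\<close>. The Hessian is \<open>(1/\<gamma>) \<Sum>\<^sub>j p\<^sub>j a\<^sub>j a\<^sub>j\<^sup>T\<close>, while the gap is
  \<open>\<gamma> \<Sum>\<^sub>j p\<^sub>j\<close> up to an affine function of \<open>u\<close>. Both are therefore governed by the same
  exponentials, and the two claims compare them along a ray \<open>u = t v\<close> with \<open>t \<rightarrow> \<infinity>\<close>.

  For the lower bound on \<open>\<nu>\<close>, let \<open>v\<close> be the longest column of the block, extended by zero. By
  Cauchy--Schwarz no exponent \<open>a\<^sub>j \<bullet> v\<close> exceeds \<open>\<rho>\<^sup>2 = a\<^sub>k \<bullet> v\<close>, where \<open>k\<close> is the index of that column.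
  After division by \<open>exp (t \<rho>\<^sup>2 / \<gamma>)\<close> only the terms with maximal exponent survive
  (\<open>tendsto_exp_sum_normalized\<close>). If \<open>E > 0\<close> is the sum of their weights, the quadratic form of
  the Hessian at \<open>v\<close> tends to \<open>E \<rho>\<^sup>4 / \<gamma>\<close>, the gap to \<open>\<gamma> E\<close>, and the contribution of \<open>\<Psi>\<close>
  vanishes. So \<open>E \<rho>\<^sup>4 / \<gamma> \<le> \<nu> \<rho>\<^sup>2 \<gamma> E\<close>, which is the bound (\<open>block_slope_lower_bound\<close>).

  For a scaled indicator row \<open>i\<close> the critical slope makes the exponentials of the columns with
  \<open>A\<^sub>i\<^sub>j = \<rho>\<^sub>i\<close> cancel exactly, whatever \<open>u\<close> is. The remaining columns do not feel a move along the
  axis \<open>i\<close>, so on the ray \<open>u = t e\<^sub>i\<close> what is left of the right-hand side is affine in \<open>t\<close> with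
  leading term \<open>- t b\<^sub>i\<close> times a positive constant. Since \<open>b = A x\<close> with \<open>x > 0\<close>, the entry \<open>b\<^sub>i\<close> is
  positive, and no constant \<open>\<kappa>\<close> can compensate (\<open>indicator_row_unbounded\<close>).
\<close>

section \<open>Derivatives of the sum-exp dual\<close>

definition sum_exp_weight :: "real^'n^'m \<Rightarrow> real^'n \<Rightarrow> real \<Rightarrow> real^'m \<Rightarrow> 'n \<Rightarrow> real" where
  "sum_exp_weight A c \<gamma> u j = exp ((column j A \<bullet> u - c $ j) / \<gamma>)"

lemma sum_exp_weight_pos: "0 < sum_exp_weight A c \<gamma> u j"
  by (simp add: sum_exp_weight_def)

lemma sum_exp_weight_ray:
  "sum_exp_weight A c \<gamma> (t *\<^sub>R v) j
     = sum_exp_weight A c \<gamma> 0 j * exp (t * ((column j A \<bullet> v) / \<gamma>))"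
  by (simp add: sum_exp_weight_def exp_add [symmetric] diff_divide_distrib)

lemma column_inner_axis: "column j A \<bullet> axis i (1::real) = A $ i $ j"
  by (simp add: inner_axis column_def)

lemma sum_exp_dual_weight:
  "sum_exp_dual A b c \<gamma> u = - (b \<bullet> u) + \<gamma> * (\<Sum>j\<in>UNIV. sum_exp_weight A c \<gamma> u j)"
  by (simp add: sum_exp_dual_def sum_exp_weight_def)

lemma sum_exp_weight_has_derivative_axis:
  assumes "\<gamma> \<noteq> 0"
  shows "((\<lambda>t. sum_exp_weight A c \<gamma> (u + t *\<^sub>R axis i 1) j) has_real_derivative
            A $ i $ j / \<gamma> * sum_exp_weight A c \<gamma> u j) (at 0)"
  unfolding sum_exp_weight_def using assms
  by (auto intro!: derivative_eq_intros simp: inner_add_right column_inner_axis)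

lemma partial_deriv_sum_exp_dual:
  assumes "\<gamma> \<noteq> 0"
  shows "partial_deriv i (sum_exp_dual A b c \<gamma>) u
           = - (b $ i) + (\<Sum>k\<in>UNIV. A $ i $ k * sum_exp_weight A c \<gamma> u k)"
proof -
  have "((\<lambda>t. - (b \<bullet> (u + t *\<^sub>R axis i 1))
            + \<gamma> * (\<Sum>k\<in>UNIV. sum_exp_weight A c \<gamma> (u + t *\<^sub>R axis i 1) k)) has_real_derivative
          - (b $ i) + \<gamma> * (\<Sum>k\<in>UNIV. A $ i $ k / \<gamma> * sum_exp_weight A c \<gamma> u k)) (at 0)"
    by (auto intro!: derivative_eq_intros sum_exp_weight_has_derivative_axis assms
        simp: inner_add_right inner_axis)
  then show ?thesis
    using assms unfolding partial_deriv_def sum_exp_dual_weight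
    by (subst DERIV_imp_deriv) (auto simp: sum_distrib_left)
qed

lemma hessian_sum_exp_dual:
  assumes "\<gamma> \<noteq> 0"
  shows "hessian (sum_exp_dual A b c \<gamma>) u $ i $ j
           = (\<Sum>k\<in>UNIV. A $ i $ k * A $ j $ k * sum_exp_weight A c \<gamma> u k) / \<gamma>"
proof -
  have "((\<lambda>t. - (b $ j) + (\<Sum>k\<in>UNIV. A $ j $ k * sum_exp_weight A c \<gamma> (u + t *\<^sub>R axis i 1) k))
          has_real_derivative
          (\<Sum>k\<in>UNIV. A $ j $ k * (A $ i $ k / \<gamma> * sum_exp_weight A c \<gamma> u k))) (at 0)"
    by (auto intro!: derivative_eq_intros sum_exp_weight_has_derivative_axis assms sum.cong)
  moreover have "partial_deriv j (sum_exp_dual A b c \<gamma>)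
      = (\<lambda>u. - (b $ j) + (\<Sum>k\<in>UNIV. A $ j $ k * sum_exp_weight A c \<gamma> u k))"
    by (rule ext) (rule partial_deriv_sum_exp_dual [OF assms])
  ultimately have "hessian (sum_exp_dual A b c \<gamma>) u $ i $ j
      = (\<Sum>k\<in>UNIV. A $ j $ k * (A $ i $ k / \<gamma> * sum_exp_weight A c \<gamma> u k))"
    by (simp add: hessian_def partial_deriv_def [of i] DERIV_imp_deriv)
  also have "\<dots> = (\<Sum>k\<in>UNIV. A $ i $ k * A $ j $ k * sum_exp_weight A c \<gamma> u k) / \<gamma>"
    unfolding sum_divide_distrib by (rule sum.cong) simp_all
  finally show ?thesis .
qed

lemma hessian_sum_exp_dual_block_form:
  assumes "\<gamma> \<noteq> 0"
  shows "(\<Sum>i\<in>B. \<Sum>j\<in>B. v $ i * hessian (sum_exp_dual A b c \<gamma>) u $ i $ j * v $ j)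
           = (\<Sum>k\<in>UNIV. sum_exp_weight A c \<gamma> u k * (\<Sum>i\<in>B. A $ i $ k * v $ i)\<^sup>2) / \<gamma>"
proof -
  have "(\<Sum>i\<in>B. \<Sum>j\<in>B. v $ i * hessian (sum_exp_dual A b c \<gamma>) u $ i $ j * v $ j)
      = (\<Sum>i\<in>B. \<Sum>j\<in>B. \<Sum>k\<in>UNIV.
           sum_exp_weight A c \<gamma> u k * ((A $ i $ k * v $ i) * (A $ j $ k * v $ j)) / \<gamma>)"
    by (simp add: hessian_sum_exp_dual [OF assms] sum_distrib_left sum_distrib_right
        sum_divide_distrib ac_simps)
  also have "\<dots> = (\<Sum>i\<in>B. \<Sum>k\<in>UNIV. \<Sum>j\<in>B.
           sum_exp_weight A c \<gamma> u k * ((A $ i $ k * v $ i) * (A $ j $ k * v $ j)) / \<gamma>)"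
    by (intro sum.cong refl sum.swap)
  also have "\<dots> = (\<Sum>k\<in>UNIV. \<Sum>i\<in>B. \<Sum>j\<in>B.
           sum_exp_weight A c \<gamma> u k * ((A $ i $ k * v $ i) * (A $ j $ k * v $ j)) / \<gamma>)"
    by (rule sum.swap)
  also have "\<dots> = (\<Sum>k\<in>UNIV. sum_exp_weight A c \<gamma> u k * (\<Sum>i\<in>B. A $ i $ k * v $ i)\<^sup>2) / \<gamma>"
    unfolding power2_eq_square sum_product unfolding sum_distrib_left sum_divide_distrib ..
  finally show ?thesis .
qed

section \<open>The slope lower bound for a block\<close>

text \<open>A sum of exponentials with bounded rates behaves like its fastest terms alone.\<close>

lemma tendsto_exp_sum_normalized:
  fixes w s :: "'a \<Rightarrow> real"
  assumes "\<And>j. j \<in> I \<Longrightarrow> s j \<le> r"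
  shows "((\<lambda>t. (\<Sum>j\<in>I. w j * exp (t * s j)) * exp (- t * r))
            \<longlongrightarrow> (\<Sum>j\<in>I. if s j = r then w j else 0)) at_top"
proof -
  have "((\<lambda>t. w j * exp (t * (s j - r))) \<longlongrightarrow> (if s j = r then w j else 0)) at_top"
    if "j \<in> I" for j
  proof (cases "s j = r")
    case False
    define d where "d = s j - r"
    have "d < 0" using False assms [OF that] by (simp add: d_def)
    then have "((\<lambda>t. exp (t * d)) \<longlongrightarrow> 0) at_top"
      by real_asymp
    then show ?thesis
      using False by (simp add: tendsto_mult_right_zero d_def)
  qed simp
  then have "((\<lambda>t. \<Sum>j\<in>I. w j * exp (t * (s j - r)))
      \<longlongrightarrow> (\<Sum>j\<in>I. if s j = r then w j else 0)) at_top"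
    by (rule tendsto_sum)
  moreover have "w j * exp (t * (s j - r)) = w j * exp (t * s j) * exp (- t * r)" for j t
    by (simp add: exp_add [symmetric] right_diff_distrib)
  ultimately show ?thesis
    by (simp only: sum_distrib_right)
qed

text \<open>The asymptotic comparison in one variable: the terms of maximal rate \<open>r\<close> must satisfy
  the inequality by themselves, and on those terms \<open>s\<^sub>j\<^sup>2 = r\<^sup>2\<close> is a common factor.\<close>

lemma slope_bound_of_exp_sum_inequality:
  fixes w s :: "'a \<Rightarrow> real"
  assumes fin: "finite I"
    and wpos: "\<And>j. j \<in> I \<Longrightarrow> 0 < w j"
    and le: "\<And>j. j \<in> I \<Longrightarrow> s j \<le> r"
    and k: "k \<in> I" "s k = r" and r: "0 < r"
    and ineq: "\<And>t. (\<Sum>j\<in>I. w j * (s j)\<^sup>2 * exp (t * s j))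
                 \<le> \<alpha> + \<beta> * t + \<mu> * (\<Sum>j\<in>I. w j * exp (t * s j))"
  shows "r\<^sup>2 \<le> \<mu>"
proof -
  define E where "E = (\<Sum>j\<in>I. if s j = r then w j else 0)"
  have "w k = (if s k = r then w k else 0)" using k by simp
  also have "\<dots> \<le> E"
    unfolding E_def by (rule member_le_sum) (use k fin wpos in \<open>auto intro: less_imp_le\<close>)
  finally have E: "0 < E" using wpos [OF k(1)] by linarith
  have "(\<Sum>j\<in>I. if s j = r then w j * (s j)\<^sup>2 else 0) = E * r\<^sup>2"
    unfolding E_def sum_distrib_right by (rule sum.cong) auto
  then have lhs: "((\<lambda>t. (\<Sum>j\<in>I. w j * (s j)\<^sup>2 * exp (t * s j)) * exp (- t * r)) \<longlongrightarrow> E * r\<^sup>2) at_top"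
    using tendsto_exp_sum_normalized [of I s r "\<lambda>j. w j * (s j)\<^sup>2"] le by simp
  have affine: "((\<lambda>t. (\<alpha> + \<beta> * t) * exp (- t * r)) \<longlongrightarrow> 0) at_top"
    using r by real_asymp
  have "((\<lambda>t. (\<alpha> + \<beta> * t) * exp (- t * r)
          + \<mu> * ((\<Sum>j\<in>I. w j * exp (t * s j)) * exp (- t * r))) \<longlongrightarrow> 0 + \<mu> * E) at_top"
    unfolding E_def
    by (intro tendsto_add affine tendsto_mult tendsto_const tendsto_exp_sum_normalized le)
  then have rhs: "((\<lambda>t. (\<alpha> + \<beta> * t + \<mu> * (\<Sum>j\<in>I. w j * exp (t * s j))) * exp (- t * r))
      \<longlongrightarrow> \<mu> * E) at_top"
    by (simp add: algebra_simps)
  have "E * r\<^sup>2 \<le> \<mu> * E"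
    by (rule tendsto_le [OF _ rhs lhs]) (auto intro!: always_eventually mult_right_mono ineq)
  with E show ?thesis by (simp add: mult.commute)
qed

lemma block_radius_attained: "\<exists>k. block_radius A B = L2_set (\<lambda>i. A $ i $ k) B"
proof -
  have "Max (range (\<lambda>j. L2_set (\<lambda>i. A $ i $ j) B)) \<in> range (\<lambda>j. L2_set (\<lambda>i. A $ i $ j) B)"
    by (rule Max_in) auto
  then show ?thesis
    unfolding block_radius_def by (rule rangeE) (rule exI)
qed

lemma L2_set_column_le_block_radius: "L2_set (\<lambda>i. A $ i $ j) B \<le> block_radius A B"
  unfolding block_radius_def by (rule Max_ge) auto

lemma block_radius_pos:
  assumes "i \<in> B" "row i A \<noteq> 0"
  shows "0 < block_radius A B"
proof -
  obtain j where "A $ i $ j \<noteq> 0"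
    using assms(2) by (auto simp: row_def vec_eq_iff)
  then have "0 < \<bar>A $ i $ j\<bar>" by simp
  also have "\<bar>A $ i $ j\<bar> \<le> L2_set (\<lambda>i. \<bar>A $ i $ j\<bar>) B"
    using assms(1) by (intro member_le_L2_set) auto
  also have "\<dots> = L2_set (\<lambda>i. A $ i $ j) B"
    by (simp add: L2_set_def)
  also have "\<dots> \<le> block_radius A B"
    by (rule L2_set_column_le_block_radius)
  finally show ?thesis by simp
qed

lemma loewner_le_onD:
  assumes "loewner_le_on B M (\<Psi> + d *\<^sub>R mat 1)"
  shows "(\<Sum>i\<in>B. \<Sum>j\<in>B. v $ i * M $ i $ j * v $ j)
           \<le> (\<Sum>i\<in>B. \<Sum>j\<in>B. v $ i * \<Psi> $ i $ j * v $ j) + d * (\<Sum>i\<in>B. (v $ i)\<^sup>2)"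
proof -
  have "v $ i * (if i = j then d else 0) * v $ j = (if i = j then d * (v $ i)\<^sup>2 else 0)" for i j
    by (simp add: power2_eq_square)
  then have diag: "(\<Sum>i\<in>B. \<Sum>j\<in>B. v $ i * (d *\<^sub>R mat 1) $ i $ j * v $ j) = d * (\<Sum>i\<in>B. (v $ i)\<^sup>2)"
    by (simp add: mat_def if_distrib [of "(*) d"] sum_distrib_left cong: if_cong)
  have "0 \<le> (\<Sum>i\<in>B. \<Sum>j\<in>B. v $ i * (\<Psi> + d *\<^sub>R mat 1 - M) $ i $ j * v $ j)"
    using assms by (simp add: loewner_le_on_def psd_on_def)
  also have "\<dots> = (\<Sum>i\<in>B. \<Sum>j\<in>B. v $ i * \<Psi> $ i $ j * v $ j)
      + (\<Sum>i\<in>B. \<Sum>j\<in>B. v $ i * (d *\<^sub>R mat 1) $ i $ j * v $ j)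
      - (\<Sum>i\<in>B. \<Sum>j\<in>B. v $ i * M $ i $ j * v $ j)"
    by (simp add: sum.distrib [symmetric] sum_subtractf [symmetric] algebra_simps
        del: vector_scaleR_component)
  finally show ?thesis using diag by linarith
qed

text \<open>Along \<open>v\<close> the curvature carried by a weight \<open>p\<^sub>j\<close> is proportional to \<open>(a\<^sub>j \<bullet> v)\<^sup>2\<close> and its growth
  rate to \<open>a\<^sub>j \<bullet> v\<close>. When \<open>v\<close> is the longest block column, both are largest at the same columns,
  namely those that agree with \<open>v\<close> on the block; so the curvature that dominates the limit is
  the largest possible one.\<close>

lemma block_slope_lower_bound:
  fixes A :: "real^'n^'m"
  assumes \<gamma>: "0 < \<gamma>"
    and \<rho>: "0 < block_radius A B"
    and bound: "\<And>u. loewner_le_on B (hessian (sum_exp_dual A b c \<gamma>) u)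
                   (\<Psi> + (\<nu> * sum_exp_gap A b c \<gamma> u) *\<^sub>R mat 1)"
  shows "(block_radius A B)\<^sup>2 / \<gamma>\<^sup>2 \<le> \<nu>"
proof -
  obtain k where k: "block_radius A B = L2_set (\<lambda>i. A $ i $ k) B"
    using block_radius_attained by blast
  define \<rho> where "\<rho> = block_radius A B"
  have \<rho>_pos: "0 < \<rho>" using \<rho> by (simp add: \<rho>_def)
  define v :: "real^'m" where "v = (\<chi> i. if i \<in> B then A $ i $ k else 0)"
  define s where "s j = (\<Sum>i\<in>B. A $ i $ j * v $ i)" for j
  define w where "w j = sum_exp_weight A c \<gamma> 0 j" for j
  define m where "m = (INF v. sum_exp_dual A b c \<gamma> v)"
  define C where "C = (\<Sum>i\<in>B. \<Sum>j\<in>B. v $ i * \<Psi> $ i $ j * v $ j)"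
  have v_sq: "(\<Sum>i\<in>B. (v $ i)\<^sup>2) = \<rho>\<^sup>2"
    using k by (simp add: v_def \<rho>_def L2_set_def sum_nonneg)
  have s_k: "s k = \<rho>\<^sup>2"
    unfolding v_sq [symmetric] by (simp add: s_def v_def power2_eq_square)
  have s_le: "s j \<le> \<rho>\<^sup>2" for j
  proof -
    have "s j = (\<Sum>i\<in>B. A $ i $ j * A $ i $ k)"
      by (simp add: s_def v_def)
    also have "\<dots> \<le> (\<Sum>i\<in>B. \<bar>A $ i $ j\<bar> * \<bar>A $ i $ k\<bar>)"
      by (rule sum_mono) (simp flip: abs_mult)
    also have "\<dots> \<le> L2_set (\<lambda>i. A $ i $ j) B * L2_set (\<lambda>i. A $ i $ k) B"
      by (rule L2_set_mult_ineq)
    also have "\<dots> \<le> \<rho> * \<rho>"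
      using \<rho>_pos by (intro mult_mono)
        (auto simp: \<rho>_def L2_set_nonneg L2_set_column_le_block_radius)
    finally show ?thesis by (simp add: power2_eq_square)
  qed
  have s_inner: "column j A \<bullet> v = s j" for j
    unfolding s_def inner_vec_def
    by (rule sum.mono_neutral_cong_right) (auto simp: v_def column_def)
  have ray: "sum_exp_weight A c \<gamma> (t *\<^sub>R v) j = w j * exp (t * (s j / \<gamma>))" for t j
    by (simp add: sum_exp_weight_ray s_inner w_def)
  have ineq: "(\<Sum>j\<in>UNIV. w j * (s j / \<gamma>)\<^sup>2 * exp (t * (s j / \<gamma>)))
      \<le> (C - \<nu> * \<rho>\<^sup>2 * m) / \<gamma> + (- \<nu> * \<rho>\<^sup>2 * (b \<bullet> v) / \<gamma>) * t
        + \<nu> * \<rho>\<^sup>2 * (\<Sum>j\<in>UNIV. w j * exp (t * (s j / \<gamma>)))" for t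
  proof -
    define S where "S = (\<Sum>j\<in>UNIV. w j * exp (t * (s j / \<gamma>)))"
    have gap: "sum_exp_gap A b c \<gamma> (t *\<^sub>R v) = - t * (b \<bullet> v) + \<gamma> * S - m"
      by (simp add: sum_exp_gap_def m_def sum_exp_dual_weight ray S_def)
    have "(\<Sum>j\<in>UNIV. w j * (s j / \<gamma>)\<^sup>2 * exp (t * (s j / \<gamma>)))
        = (\<Sum>j\<in>UNIV. w j * exp (t * (s j / \<gamma>)) * (s j)\<^sup>2) / \<gamma> / \<gamma>"
      by (simp add: sum_divide_distrib power_divide power2_eq_square ac_simps)
    also have "\<dots> \<le> (C + \<nu> * sum_exp_gap A b c \<gamma> (t *\<^sub>R v) * \<rho>\<^sup>2) / \<gamma>"
      using loewner_le_onD [OF bound [of "t *\<^sub>R v"], of v] \<gamma>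
      unfolding hessian_sum_exp_dual_block_form [OF less_imp_neq [OF \<gamma>, symmetric]] v_sq
      by (intro divide_right_mono) (simp_all add: ray s_def C_def)
    also have "\<dots> = (C - \<nu> * \<rho>\<^sup>2 * m) / \<gamma> + (- \<nu> * \<rho>\<^sup>2 * (b \<bullet> v) / \<gamma>) * t + \<nu> * \<rho>\<^sup>2 * S"
      using \<gamma> by (simp add: gap field_simps)
    finally show ?thesis by (simp add: S_def)
  qed
  have "(\<rho>\<^sup>2 / \<gamma>)\<^sup>2 \<le> \<nu> * \<rho>\<^sup>2"
    by (rule slope_bound_of_exp_sum_inequality
        [where I = UNIV and w = w and s = "\<lambda>j. s j / \<gamma>" and k = k, OF _ _ _ _ _ _ ineq])
      (use \<gamma> \<rho>_pos s_le s_k in \<open>auto simp: w_def sum_exp_weight_pos divide_right_mono\<close>)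
  then have "(\<rho>\<^sup>2 / \<gamma>\<^sup>2) * \<rho>\<^sup>2 \<le> \<nu> * \<rho>\<^sup>2"
    by (simp add: power_divide power2_eq_square)
  then show ?thesis
    unfolding \<rho>_def [symmetric] by (rule mult_right_le_imp_le) (use \<rho>_pos in simp)
qed

section \<open>Failure at the critical slope for indicator rows\<close>

text \<open>Feasibility of a strictly positive \<open>x\<close> makes the dual decrease linearly in the direction
  \<open>e\<^sub>i\<close> once the exponentials are discounted; this is the drift that no constant absorbs.\<close>

lemma rhs_entry_pos:
  assumes "\<And>j. 0 < x $ j" and "A *v x = b"
    and "\<And>j. 0 \<le> A $ i $ j" and "A $ i $ k > 0"
  shows "0 < (b::real^'m) $ i"
proof -
  have "b $ i = (\<Sum>j\<in>UNIV. A $ i $ j * x $ j)"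
    using assms(2) by (auto simp: matrix_vector_mult_def)
  also have "\<dots> > 0"
    using assms by (intro sum_pos2 [of _ k]) (auto intro!: mult_nonneg_nonneg intro: less_imp_le)
  finally show ?thesis .
qed

lemma row_radius_attained: "\<exists>k. row_radius A i = \<bar>A $ i $ k\<bar>"
proof -
  have "Max (range (\<lambda>j. \<bar>A $ i $ j\<bar>)) \<in> range (\<lambda>j. \<bar>A $ i $ j\<bar>)"
    by (rule Max_in) auto
  then show ?thesis
    unfolding row_radius_def by (rule rangeE) (rule exI)
qed

lemma indicator_row_unbounded:
  fixes A :: "real^'n^'m"
  assumes \<gamma>: "0 < \<gamma>" and r: "0 < r" and ind: "\<And>j. A $ i $ j \<in> {0, r}" and b: "0 < b $ i"
  shows "\<exists>u. \<kappa> + r\<^sup>2 / \<gamma>\<^sup>2 * sum_exp_gap A b c \<gamma> u < hessian (sum_exp_dual A b c \<gamma>) u $ i $ i"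
proof -
  define m where "m = (INF v. sum_exp_dual A b c \<gamma> v)"
  define p where "p t j = sum_exp_weight A c \<gamma> (t *\<^sub>R axis i 1) j" for t j
  define R where "R = (\<Sum>j\<in>UNIV. (if A $ i $ j = 0 then sum_exp_weight A c \<gamma> 0 j else 0))"
  \<comment> \<open>Chosen so that the curvature exceeds the bound by exactly \<open>r\<^sup>2 / \<gamma>\<^sup>2\<close>.\<close>
  define t where "t = (\<gamma>\<^sup>2 / r\<^sup>2 * \<kappa> + \<gamma> * R - m + 1) / b $ i"
  define u :: "real^'m" where "u = t *\<^sub>R axis i 1"
  have split: "p t j = A $ i $ j * A $ i $ j * p t j / r\<^sup>2
      + (if A $ i $ j = 0 then sum_exp_weight A c \<gamma> 0 j else 0)" for j
    using ind [of j] r by (auto simp: p_def sum_exp_weight_ray column_inner_axis power2_eq_square)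
  have "(\<Sum>j\<in>UNIV. p t j) = (\<Sum>j\<in>UNIV. A $ i $ j * A $ i $ j * p t j) / r\<^sup>2 + R"
    by (subst split) (simp add: sum.distrib R_def sum_divide_distrib)
  moreover have "hessian (sum_exp_dual A b c \<gamma>) u $ i $ i
      = (\<Sum>j\<in>UNIV. A $ i $ j * A $ i $ j * p t j) / \<gamma>"
    using \<gamma> by (simp add: hessian_sum_exp_dual p_def u_def)
  ultimately have "(\<Sum>j\<in>UNIV. p t j) = \<gamma> / r\<^sup>2 * hessian (sum_exp_dual A b c \<gamma>) u $ i $ i + R"
    using \<gamma> by simp
  moreover have "sum_exp_gap A b c \<gamma> u = - t * b $ i + \<gamma> * (\<Sum>j\<in>UNIV. p t j) - m"
    by (simp add: sum_exp_gap_def m_def sum_exp_dual_weight p_def u_def inner_axis)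
  moreover have "t * b $ i = \<gamma>\<^sup>2 / r\<^sup>2 * \<kappa> + \<gamma> * R - m + 1"
    using b by (simp add: t_def)
  ultimately have "sum_exp_gap A b c \<gamma> u
      = \<gamma>\<^sup>2 / r\<^sup>2 * hessian (sum_exp_dual A b c \<gamma>) u $ i $ i - \<gamma>\<^sup>2 / r\<^sup>2 * \<kappa> - 1"
    by (simp add: algebra_simps power2_eq_square)
  then have "\<kappa> + r\<^sup>2 / \<gamma>\<^sup>2 * sum_exp_gap A b c \<gamma> u
      = hessian (sum_exp_dual A b c \<gamma>) u $ i $ i - r\<^sup>2 / \<gamma>\<^sup>2"
    using \<gamma> r by (simp add: field_simps)
  also have "\<dots> < hessian (sum_exp_dual A b c \<gamma>) u $ i $ i"
    using \<gamma> r by simp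
  finally show ?thesis by blast
qed

theorem propositionB1:
  fixes A :: "real^'n^'m" and b u_star :: "real^'m" and c :: "real^'n" and \<gamma> :: real
  assumes "\<gamma> > 0"
    and "\<exists>q. transpose A *v q = 1 \<and> q \<bullet> b = 1"
    and "\<exists>x. (\<forall>j. 0 < x $ j) \<and> A *v x = b"
    and "is_arg_min (sum_exp_dual A b c \<gamma>) (\<lambda>_. True) u_star"
  shows "(\<forall>(B::'m set) (\<Psi>::real^'m^'m) \<nu>::real.
            (\<exists>i\<in>B. row i A \<noteq> 0) \<longrightarrow> psd_on B \<Psi> \<longrightarrow> 0 \<le> \<nu> \<longrightarrow>
            (\<forall>u. loewner_le_on B (hessian (sum_exp_dual A b c \<gamma>) u)
                   (\<Psi> + (\<nu> * sum_exp_gap A b c \<gamma> u) *\<^sub>R mat 1)) \<longrightarrow>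
            (block_radius A B)\<^sup>2 / \<gamma>\<^sup>2 \<le> \<nu>)
       \<and> (\<forall>i::'m. 0 < row_radius A i \<longrightarrow> (\<forall>j. A $ i $ j \<in> {0, row_radius A i}) \<longrightarrow>
            \<not> (\<exists>\<kappa>::real. \<forall>u. hessian (sum_exp_dual A b c \<gamma>) u $ i $ i
                   \<le> \<kappa> + (row_radius A i)\<^sup>2 / \<gamma>\<^sup>2 * sum_exp_gap A b c \<gamma> u))"
proof (intro conjI allI impI)
  fix B :: "'m set" and \<Psi> :: "real^'m^'m" and \<nu> :: real
  assume "\<exists>i\<in>B. row i A \<noteq> 0"
    and "\<forall>u. loewner_le_on B (hessian (sum_exp_dual A b c \<gamma>) u)
               (\<Psi> + (\<nu> * sum_exp_gap A b c \<gamma> u) *\<^sub>R mat 1)"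
  then show "(block_radius A B)\<^sup>2 / \<gamma>\<^sup>2 \<le> \<nu>"
    using block_slope_lower_bound [OF assms(1)] block_radius_pos by blast
next
  fix i :: 'm
  assume pos: "0 < row_radius A i" and ind: "\<forall>j. A $ i $ j \<in> {0, row_radius A i}"
  obtain x where x: "\<And>j. 0 < x $ j" "A *v x = b"
    using assms(3) by blast
  obtain k where "row_radius A i = \<bar>A $ i $ k\<bar>"
    using row_radius_attained by blast
  moreover have nonneg: "0 \<le> A $ i $ j" for j
    using ind [rule_format, of j] pos by auto
  ultimately have "0 < A $ i $ k" using pos by simp
  with x nonneg have "0 < b $ i" by (rule rhs_entry_pos)
  with indicator_row_unbounded [OF assms(1) pos] ind
  show "\<not> (\<exists>\<kappa>::real. \<forall>u. hessian (sum_exp_dual A b c \<gamma>) u $ i $ i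
                   \<le> \<kappa> + (row_radius A i)\<^sup>2 / \<gamma>\<^sup>2 * sum_exp_gap A b c \<gamma> u)"
    by (meson not_less)
qed

end
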